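(* Let $A\in\mathbb{C}^{n\times n}$ be Hermitian positive semi-definite with eigenvalue decomposition $A=U\Lambda U^*$, $U$ unitary, $\Lambda=\mathrm{diag}(\lambda_1,\dots,\lambda_n)$, $\lambda_1\ge\cdots\ge\lambda_n$, and let $k$ satisfy $\lambda_k>\lambda_{k+1}>0$. Partition $U=(U_1,U_2)$ with $U_1\in\mathbb{C}^{n\times k}$ and let $\Lambda_2=\mathrm{diag}(\lambda_{k+1},\dots,\lambda_n)$. Let $q\ge1$, $k\le l\le n$, and let $\Omega\in\mathbb{C}^{n\times l}$ be any matrix such that $\widehat\Omega_1=U_1^*\Omega\in\mathbb{C}^{k\times l}$ has rank $k$ and $K_q=(A\Omega,A^2\Omega,\dots,A^q\Omega)$ has full column rank $ql$. Let $\widehat\Omega_2=U_2^*\Omega$, let $K_q=Q_qR_q$ be the thin QR factorization and $T=Q_q^*AQ_q$. Then $$0\le\mathrm{Tr}(A)-\mathrm{Tr}(T)\le\left(1+T_{q-1}^{-1}\!\left(\frac{2\lambda_k-\lambda_{k+1}}{\lambda_{k+1}}\right)\|\widehat\Omega_2\widehat\Omega_1^\dagger\|_2\right)\mathrm{Tr}(\Lambda_2).$$ Moreover, when $0<\|\widehat\Omega_2\widehat\Omega_1^\dagger\|_2\le\frac{\lambda_k}{\lambda_{k+1}}T_{q-1}\!\left(\frac{2\lambda_k-\lambda_{k+1}}{\lambda_{k+1}}\right)$, the following (tighter) bound holds: $$0\le\mathrm{Tr}(A)-\mathrm{Tr}(T)\le\left(1+\frac{\lambda_{k+1}}{\lam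bda_k}T_{q-1}^{-2}\!\left(\frac{2\lambda_k-\lambda_{k+1}}{\lambda_{k+1}}\right)\|\widehat\Omega_2\widehat\Omega_1^\dagger\|_2^2\right)\mathrm{Tr}(\Lambda_2).$$
   Context: $X^\dagger$ denotes the Moore–Penrose inverse and $\|\cdot\|_2$ the spectral norm. $T_m$ is the Chebyshev polynomial of the first kind of degree $m$; for $x\ge1$, $T_m(x)=\frac{(x+\sqrt{x^2-1})^m+(x-\sqrt{x^2-1})^m}{2}$; $T_m^{-1}(x)=1/T_m(x)$ and $T_m^{-2}(x)=1/T_m(x)^2$. *)

theory Defs
  imports "Jordan_Normal_Form.Schur_Decomposition" "Jordan_Normal_Form.DL_Rank"
begin

text \<open>Conjugate transpose is the library's mat_adjoint. Complex numbers carry the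
  partial order of HOL-Library.Complex_Order (a \<le> b iff Re a \<le> Re b and Im a = Im b).\<close>

definition mat_trace :: "'a::comm_ring_1 mat \<Rightarrow> 'a" where
  "mat_trace A = (\<Sum>i<dim_row A. A $$ (i,i))"

definition hermitian_mat :: "complex mat \<Rightarrow> bool" where
  "hermitian_mat A \<longleftrightarrow> A \<in> carrier_mat (dim_row A) (dim_row A) \<and> mat_adjoint A = A"

definition psd_mat :: "complex mat \<Rightarrow> bool" where
  "psd_mat A \<longleftrightarrow> hermitian_mat A \<and>
     (\<forall>v \<in> carrier_vec (dim_row A). 0 \<le> (\<Sum>i<dim_row A. cnj (vec_index v i) * vec_index (A *\<^sub>v v) i))"

definition unitary_mat :: "complex mat \<Rightarrow> bool" where
  "unitary_mat U \<longleftrightarrow> U \<in> carrier_mat (dim_row U) (dim_row U) \<and>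
     mat_adjoint U * U = 1\<^sub>m (dim_row U) \<and> U * mat_adjoint U = 1\<^sub>m (dim_row U)"

definition vnorm :: "complex vec \<Rightarrow> real" where
  "vnorm v = sqrt (\<Sum>i<dim_vec v. (cmod (vec_index v i))\<^sup>2)"

definition spec_norm :: "complex mat \<Rightarrow> real" where
  "spec_norm X = Sup {vnorm (X *\<^sub>v v) | v. v \<in> carrier_vec (dim_col X) \<and> vnorm v \<le> 1}"

definition pinv :: "complex mat \<Rightarrow> complex mat" where
  "pinv X = (THE Y. Y \<in> carrier_mat (dim_col X) (dim_row X) \<and>
      X * Y * X = X \<and> Y * X * Y = Y \<and>
      mat_adjoint (X * Y) = X * Y \<and> mat_adjoint (Y * X) = Y * X)"

definition mat_rank :: "complex mat \<Rightarrow> nat" where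
  "mat_rank A = vec_space.rank (dim_row A) A"

fun cheb :: "nat \<Rightarrow> real \<Rightarrow> real" where
  "cheb 0 x = 1"
| "cheb (Suc 0) x = x"
| "cheb (Suc (Suc m)) x = 2 * x * cheb (Suc m) x - cheb m x"

definition col_block :: "complex mat \<Rightarrow> nat \<Rightarrow> nat \<Rightarrow> complex mat" where
  "col_block U j c = mat (dim_row U) c (\<lambda>(a,b). U $$ (a, j + b))"

text \<open>Block Krylov matrix K_q = (A \<Omega>, A^2 \<Omega>, ..., A^q \<Omega>): n x (q l).\<close>
definition krylov :: "complex mat \<Rightarrow> complex mat \<Rightarrow> nat \<Rightarrow> complex mat" where
  "krylov A \<Omega> q = mat (dim_row \<Omega>) (q * dim_col \<Omega>)
     (\<lambda>(a,b). ((A ^\<^sub>m (b div dim_col \<Omega> + 1)) * \<Omega>) $$ (a, b mod dim_col \<Omega>))"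

definition thin_QR :: "complex mat \<Rightarrow> complex mat \<Rightarrow> complex mat \<Rightarrow> bool" where
  "thin_QR K Q R \<longleftrightarrow> Q \<in> carrier_mat (dim_row K) (dim_col K) \<and>
     R \<in> carrier_mat (dim_col K) (dim_col K) \<and>
     mat_adjoint Q * Q = 1\<^sub>m (dim_col K) \<and> upper_triangular R \<and>
     (\<forall>i<dim_col K. 0 < R $$ (i,i)) \<and> K = Q * R"

end

theory Submission
  imports Defs "HOL-Analysis.Convex" "HOL-Analysis.L2_Norm"
begin

text \<open>Let \<open>N = 1 - Q Q\<^sup>*\<close> and \<open>S = U\<^sup>* N U\<close>, an orthogonal projector. The error in the
  trace is \<open>\<Sum>i<n. lam i * S i i\<close>, and \<open>0 \<le> S i i \<le> 1\<close>, so the indices \<open>i \<ge> k\<close> contribute at most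
  the trace of \<open>\<Lambda>\<^sub>2\<close>. Since \<open>N\<close> kills \<open>\<phi>(A) \<Omega>\<close> for every polynomial \<open>\<phi>(x) = x \<psi>(x)\<close> with
  \<open>degree \<psi> < q\<close>, applying this to the columns of \<open>\<Omega>\<^sub>1\<^sup>\<dagger>\<close> expresses column \<open>i < k\<close> of \<open>S\<close> through the
  columns \<open>j \<ge> k\<close>, with coefficients \<open>- F j i\<close> where
  \<open>F = \<phi>(\<Lambda>\<^sub>2) \<Omega>\<^sub>2 \<Omega>\<^sub>1\<^sup>\<dagger> \<phi>(\<Lambda>\<^sub>1)\<^sup>-\<^sup>1\<close>. Taking \<open>\<psi>\<close> to be the Chebyshev polynomial scaled to
  \<open>[0, lam k]\<close>, one gets the first bound by substituting this relation once in
  \<open>\<Sum>i<k. lam i * S i i\<close>, and the second from \<open>S i i \<le> \<Sum>j\<ge>k. \<bar>F j i\<bar>\<^sup>2\<close>, which is the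
  Cauchy-Schwarz inequality combined with \<open>S i i = \<Sum>j. \<bar>S i j\<bar>\<^sup>2\<close>.\<close>

section \<open>Chebyshev polynomials: bounds on [-1, 1], growth beyond 1, affine
  substitution\<close>

text \<open>The three-term recurrence is the addition formula for the cosine. This turns the bound
  by one on [-1, 1] into a bound on a cosine.\<close>

lemma cheb_cos: "cheb m (cos t) = cos (real m * t)"
proof (induction m "cos t" rule: cheb.induct)
  case (3 m)
  have "cos (real (Suc (Suc m)) * t) + cos (real m * t) = 2 * cos t * cos (real (Suc m) * t)"
    using cos_add[of "real (Suc m) * t" t] cos_diff[of "real (Suc m) * t" t]
    by (simp add: algebra_simps)
  then show ?case using 3 by simp
qed auto

lemma cheb_abs_le_one:
  assumes "\<bar>x\<bar> \<le> 1" shows "\<bar>cheb m x\<bar> \<le> 1"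
  using cheb_cos[of m "arccos x"] assms by (simp add: cos_arccos_abs)

text \<open>The increments \<open>cheb (Suc m) x - cheb m x\<close> satisfy a recurrence with nonnegative
  terms for \<open>x \<ge> 1\<close>, so they are carried along in the induction.\<close>

lemma cheb_mono_aux:
  assumes "1 \<le> x" "x \<le> y"
  shows "1 \<le> cheb m x \<and> cheb m x \<le> cheb m y \<and> cheb m x \<le> cheb (Suc m) x \<and>
    cheb (Suc m) x - cheb m x \<le> cheb (Suc m) y - cheb m y"
proof (induction m)
  case 0
  then show ?case using assms by simp
next
  case (Suc m)
  have step: "cheb (Suc (Suc m)) z - cheb (Suc m) z
      = 2 * (z - 1) * cheb (Suc m) z + (cheb (Suc m) z - cheb m z)" for z :: real
    by (simp add: algebra_simps)
  have le: "1 \<le> cheb (Suc m) x" "cheb (Suc m) x \<le> cheb (Suc m) y"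
    using Suc by linarith+
  have "2 * (x - 1) * cheb (Suc m) x \<le> 2 * (y - 1) * cheb (Suc m) y"
    using le assms by (intro mult_mono) auto
  moreover have "0 \<le> 2 * (x - 1) * cheb (Suc m) x"
    using le assms by simp
  ultimately show ?case using Suc le step[of x] step[of y] by linarith
qed

lemma cheb_ge_one: "1 \<le> x \<Longrightarrow> 1 \<le> cheb m x"
  using cheb_mono_aux[of x x] by simp

lemma cheb_mono: "1 \<le> x \<Longrightarrow> x \<le> y \<Longrightarrow> cheb m x \<le> cheb m y"
  using cheb_mono_aux by blast

text \<open>Actual coefficients are wanted, because relations on Krylov blocks are available one
  power of the matrix at a time. The affine argument leaves room for the later rescaling of the
  spectrum.\<close>

lemma cheb_poly: "\<exists>p :: real poly. degree p \<le> m \<and> (\<forall>x. poly p x = cheb m (a * x + b))"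
proof (induction m rule: induct_nat_012)
  case 0
  show ?case by (rule exI[of _ 1]) simp
next
  case 1
  show ?case by (rule exI[of _ "[:b, a:]"]) (simp add: algebra_simps)
next
  case (ge2 m)
  then obtain p p' where p: "degree p \<le> Suc m" "\<forall>x. poly p x = cheb (Suc m) (a * x + b)"
    and p': "degree p' \<le> m" "\<forall>x. poly p' x = cheb m (a * x + b)" by blast
  have "degree ([:2 * b, 2 * a:] * p - p') \<le> Suc (Suc m)"
    using p(1) p'(1) degree_mult_le[of "[:2 * b, 2 * a:]" p]
    by (intro degree_diff_le) (auto split: if_splits)
  then show ?case using p p'
    by (intro exI[of _ "[:2 * b, 2 * a:] * p - p'"]) (simp add: algebra_simps)
qed

section \<open>Adjoints, entries of products and traces\<close>

lemma adjoint_dim [simp]: "dim_row (mat_adjoint A) = dim_col A" "dim_col (mat_adjoint A) = dim_row A"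
  by (simp_all add: mat_adjoint_def)

lemma adjoint_carrier: "A \<in> carrier_mat n m \<Longrightarrow> mat_adjoint A \<in> carrier_mat m n"
  by auto

lemma adjoint_index [simp]:
  "i < dim_col A \<Longrightarrow> j < dim_row A \<Longrightarrow> mat_adjoint A $$ (i, j) = cnj (A $$ (j, i))"
  by (simp add: mat_adjoint_def mat_of_rows_def)

lemma adjoint_adjoint [simp]: "mat_adjoint (mat_adjoint A) = (A :: complex mat)"
  by (rule eq_matI) auto

lemma adjoint_one [simp]: "mat_adjoint (1\<^sub>m n) = (1\<^sub>m n :: complex mat)"
  by (rule eq_matI) auto

lemma index_mult_sum:
  assumes "A \<in> carrier_mat n m" "B \<in> carrier_mat m p" "i < n" "j < p"
  shows "(A * B) $$ (i, j) = (\<Sum>a<m. A $$ (i, a) * B $$ (a, j))"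
  using assms by (simp add: scalar_prod_def atLeast0LessThan)

lemma adjoint_mult:
  fixes A B :: "complex mat"
  assumes "A \<in> carrier_mat n m" "B \<in> carrier_mat m p"
  shows "mat_adjoint (A * B) = mat_adjoint B * mat_adjoint A"
proof (rule eq_matI)
  fix i j assume "i < dim_row (mat_adjoint B * mat_adjoint A)" "j < dim_col (mat_adjoint B * mat_adjoint A)"
  then have ij: "i < p" "j < n" using assms by auto
  then have "mat_adjoint (A * B) $$ (i, j) = cnj (\<Sum>a<m. A $$ (j, a) * B $$ (a, i))"
    using assms by (simp add: index_mult_sum[OF assms] del: index_mult_mat(1))
  also have "\<dots> = (\<Sum>a<m. mat_adjoint B $$ (i, a) * mat_adjoint A $$ (a, j))"
    using ij assms by (simp add: mult.commute)
  also have "\<dots> = (mat_adjoint B * mat_adjoint A) $$ (i, j)"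
    using index_mult_sum[OF adjoint_carrier[OF assms(2)] adjoint_carrier[OF assms(1)] ij] by simp
  finally show "mat_adjoint (A * B) $$ (i, j) = (mat_adjoint B * mat_adjoint A) $$ (i, j)" .
qed (use assms in auto)

lemma mat_trace_comm:
  assumes "A \<in> carrier_mat n m" "B \<in> carrier_mat m n"
  shows "mat_trace (A * B) = mat_trace (B * A)"
proof -
  have "mat_trace (A * B) = (\<Sum>i<n. \<Sum>j<m. A $$ (i, j) * B $$ (j, i))"
    using assms unfolding mat_trace_def by (simp add: index_mult_sum[OF assms] del: index_mult_mat(1))
  also have "\<dots> = (\<Sum>j<m. \<Sum>i<n. B $$ (j, i) * A $$ (i, j))"
    by (subst sum.swap) (simp add: mult.commute)
  also have "\<dots> = mat_trace (B * A)"
    using assms unfolding mat_trace_def by (simp add: index_mult_sum[OF assms(2,1)] del: index_mult_mat(1))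
  finally show ?thesis .
qed

lemma mat_diag_pow: "mat_diag n f ^\<^sub>m m = mat_diag n (\<lambda>i. f i ^ m :: 'a :: comm_semiring_1)"
  by (induction m) (auto simp: mult.commute mat_diag_dim[THEN carrier_matD(1)])

section \<open>The pseudoinverse of a matrix of full row rank\<close>

text \<open>A maximal independent set of columns has \<open>k\<close> elements by the rank
  hypothesis, hence spans the whole space. A vector orthogonal to every column is then orthogonal to
  itself.\<close>

lemma full_row_rank_orthogonal_zero:
  fixes X :: "complex mat"
  assumes X: "X \<in> carrier_mat k l" and rank: "mat_rank X = k"
    and v: "v \<in> carrier_vec k" and orth: "mat_adjoint X *\<^sub>v v = 0\<^sub>v l"
  shows "v = 0\<^sub>v k"
proof -
  interpret vec_space "TYPE(complex)" k .
  have cols: "set (cols X) \<subseteq> carrier_vec k" using X cols_dim by blast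
  obtain B where B: "maximal B (\<lambda>T. T \<subseteq> set (cols X) \<and> lin_indpt T)" "finite B"
    using maximal_exists_superset[of "set (cols X)" "\<lambda>T. T \<subseteq> set (cols X) \<and> lin_indpt T" "{}"]
      lin_dep_def by auto
  then have li: "lin_indpt B" "B \<subseteq> set (cols X)" unfolding maximal_def by auto
  have "card B = k" using rank_card_indpt[OF X B(1)] rank X by (simp add: mat_rank_def)
  then have "basis B" using li B(2) cols by (intro dim_li_is_basis) (auto simp: dim_is_n)
  then have span: "span B = carrier_vec k" by (simp add: basis_def)
  \<comment> \<open>\<open>orthogonal_complement\<close> uses the bilinear product, so the vector
    has to be conjugated first.\<close>
  have "conjugate v \<in> orthogonal_complement (set (cols X))"
    unfolding orthogonal_complement_def
  proof (intro CollectI conjI ballI)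
    fix y assume "y \<in> set (cols X)"
    then obtain b where b: "b < l" "y = col X b" using X
      by (metis carrier_matD(2) cols_length cols_nth in_set_conv_nth)
    have "0 = (mat_adjoint X *\<^sub>v v) $ b" using orth b(1) by simp
    also have "\<dots> = (\<Sum>a<k. cnj (X $$ (a, b)) * v $ a)"
      using X v b(1) by (simp add: scalar_prod_def atLeast0LessThan)
    also have "\<dots> = cnj (conjugate v \<bullet> y)"
      using X v b by (simp add: scalar_prod_def atLeast0LessThan mult.commute)
    finally show "conjugate v \<bullet> y = 0" by (metis complex_cnj_zero_iff)
  qed (use v in simp)
  then have "conjugate v \<in> orthogonal_complement (carrier_vec k)"
    using orthogonal_complement_subset[OF li(2)] in_orthogonal_complement_span[of B] li(2) cols span
    by (metis subset_iff subset_trans)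
  then have "conjugate v \<bullet> v = 0" using v by (simp add: orthogonal_complement_def)
  then have "v \<bullet>c v = 0" using v by (simp add: comm_scalar_prod[of v k "conjugate v"])
  then show ?thesis using conjugate_square_eq_0_vec[OF v] by simp
qed

text \<open>The Gram matrix has trivial kernel: if it kills \<open>v\<close>, then the adjoint of
  \<open>X\<close> sends \<open>v\<close> to a vector of norm zero, and full row rank forces
  \<open>v\<close> to vanish.\<close>

lemma full_row_rank_gram_right_inverse:
  fixes X :: "complex mat"
  assumes X: "X \<in> carrier_mat k l" and rank: "mat_rank X = k"
  obtains B where "B \<in> carrier_mat k k" "X * mat_adjoint X * B = 1\<^sub>m k" "B * (X * mat_adjoint X) = 1\<^sub>m k"
proof -
  let ?G = "X * mat_adjoint X"
  note Xa = adjoint_carrier[OF X]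
  have G: "?G \<in> carrier_mat k k" using X by auto
  have "det ?G \<noteq> 0"
  proof
    assume "det ?G = 0"
    then obtain v where v: "v \<in> carrier_vec k" "v \<noteq> 0\<^sub>v k" "?G *\<^sub>v v = 0\<^sub>v k"
      using det_0_iff_vec_prod_zero_field[OF G] by blast
    define u where "u = mat_adjoint X *\<^sub>v v"
    have u: "u \<in> carrier_vec l" unfolding u_def using Xa v(1) by (rule mult_mat_vec_carrier)
    have Xu: "X *\<^sub>v u = 0\<^sub>v k" using v(3) X Xa v(1) unfolding u_def by simp
    \<comment> \<open>Moving the adjoint across turns the squared norm of \<open>u\<close> into a
      pairing of \<open>v\<close> with the zero vector \<open>X *\<^sub>v u\<close>.\<close>
    have "u \<bullet>c u = (\<Sum>b<l. u $ b * (\<Sum>a<k. X $$ (a, b) * cnj (v $ a)))"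
      using X v(1) u by (simp add: scalar_prod_def atLeast0LessThan u_def)
    also have "\<dots> = (\<Sum>a<k. cnj (v $ a) * (\<Sum>b<l. X $$ (a, b) * u $ b))"
      unfolding sum_distrib_left by (subst sum.swap) (simp add: mult_ac)
    also have "\<dots> = (\<Sum>a<k. cnj (v $ a) * (X *\<^sub>v u) $ a)"
      using X u by (simp add: scalar_prod_def atLeast0LessThan)
    also have "\<dots> = 0" unfolding Xu by simp
    finally have "u = 0\<^sub>v l" using conjugate_square_eq_0_vec[OF u] by simp
    then show False
      using full_row_rank_orthogonal_zero[OF X rank v(1)] v(2) unfolding u_def by simp
  qed
  \<comment> \<open>The argument \<open>()\<close> merely fills the extension slot of the matrix
    ring record.\<close>
  from det_non_zero_imp_unit[OF G this, of "()"]
  obtain B where "B \<in> carrier_mat k k" "B * ?G = 1\<^sub>m k" "?G * B = 1\<^sub>m k"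
    unfolding Units_def by (auto simp: ring_mat_def)
  then show ?thesis using that by blast
qed

text \<open>The candidate is the adjoint of \<open>X\<close> times the inverse Gram matrix. Since
  \<open>pinv\<close> is a definite description, the four Penrose equations are checked for it and
  its uniqueness is proved as well.\<close>

lemma pinv_full_row_rank:
  fixes X :: "complex mat"
  assumes X: "X \<in> carrier_mat k l" and rank: "mat_rank X = k"
  shows "pinv X \<in> carrier_mat l k" "X * pinv X = 1\<^sub>m k"
proof -
  note Xa = adjoint_carrier[OF X]
  obtain B where B: "B \<in> carrier_mat k k" "X * mat_adjoint X * B = 1\<^sub>m k"
    "B * (X * mat_adjoint X) = 1\<^sub>m k"
    using full_row_rank_gram_right_inverse[OF assms] .
  note Ba = adjoint_carrier[OF B(1)]
  define Y where "Y = mat_adjoint X * B"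
  have Y: "Y \<in> carrier_mat l k" unfolding Y_def using Xa B(1) by auto
  have XY: "X * Y = 1\<^sub>m k" unfolding Y_def using B(2) assoc_mult_mat[OF X Xa B(1)] by simp
  \<comment> \<open>The inverse of a Hermitian matrix is Hermitian; this is what makes
    \<open>Y * X\<close> self-adjoint.\<close>
  have "mat_adjoint B = mat_adjoint B * (X * mat_adjoint X * B)"
    using B(2) right_mult_one_mat[OF Ba] by simp
  also have "\<dots> = mat_adjoint B * (X * mat_adjoint X) * B"
    using assoc_mult_mat[OF Ba mult_carrier_mat[OF X Xa] B(1)] by simp
  also have "mat_adjoint B * (X * mat_adjoint X) = mat_adjoint (X * mat_adjoint X * B)"
    unfolding adjoint_mult[OF mult_carrier_mat[OF X Xa] B(1)] adjoint_mult[OF X Xa] by simp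
  finally have herm: "mat_adjoint B = B" using B(1,2) by simp
  have "mat_adjoint (Y * X) = mat_adjoint X * (B * X)"
    unfolding adjoint_mult[OF Y X] unfolding Y_def adjoint_mult[OF Xa B(1)] herm by simp
  then have YX: "mat_adjoint (Y * X) = Y * X"
    unfolding Y_def using assoc_mult_mat[OF Xa B(1) X] by simp
  have "Y \<in> carrier_mat (dim_col X) (dim_row X) \<and>
      X * Y * X = X \<and> Y * X * Y = Y \<and>
      mat_adjoint (X * Y) = X * Y \<and> mat_adjoint (Y * X) = Y * X"
    using X Y XY YX assoc_mult_mat[OF Y X Y] by auto
  moreover have "Z = Y" if "Z \<in> carrier_mat (dim_col X) (dim_row X) \<and>
      X * Z * X = X \<and> Z * X * Z = Z \<and>
      mat_adjoint (X * Z) = X * Z \<and> mat_adjoint (Z * X) = Z * X" for Z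
  proof -
    have Z: "Z \<in> carrier_mat l k" using that X by auto
    \<comment> \<open>Taking adjoints in \<open>X * Z * X = X\<close>, with \<open>Z * X\<close>
      self-adjoint, expresses the adjoint of \<open>X\<close> by \<open>Z\<close> and the Gram
      matrix; multiplying by \<open>B\<close> on the right identifies \<open>Z\<close>.\<close>
    have "mat_adjoint X = mat_adjoint (X * Z * X)" using that by simp
    also have "\<dots> = mat_adjoint (X * (Z * X))" using assoc_mult_mat[OF X Z X] by simp
    also have "\<dots> = Z * X * mat_adjoint X"
      using adjoint_mult[OF X mult_carrier_mat[OF Z X]] that by simp
    also have "\<dots> = Z * (X * mat_adjoint X)" using assoc_mult_mat[OF Z X Xa] .
    finally have "Y = Z * (X * mat_adjoint X) * B" unfolding Y_def by simp
    also have "\<dots> = Z" using assoc_mult_mat[OF Z mult_carrier_mat[OF X Xa] B(1)] B(2) Z by simp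
    finally show "Z = Y" by simp
  qed
  ultimately have "pinv X = Y" unfolding pinv_def by (intro the_equality) blast+
  then show "pinv X \<in> carrier_mat l k" "X * pinv X = 1\<^sub>m k" using Y XY by simp_all
qed

section \<open>Euclidean and spectral norm\<close>

lemma vnorm_L2: "vnorm v = L2_set (\<lambda>i. cmod (v $ i)) {..<dim_vec v}"
  by (simp add: vnorm_def L2_set_def)

lemma vnorm_nonneg: "0 \<le> vnorm v"
  by (simp add: vnorm_L2)

lemma cmod_le_vnorm: "i < dim_vec v \<Longrightarrow> cmod (v $ i) \<le> vnorm v"
  unfolding vnorm_L2 by (rule member_le_L2_set) auto

lemma vnorm_smult: "vnorm (a \<cdot>\<^sub>v v) = cmod a * vnorm v"
  unfolding vnorm_def
  by (simp add: norm_mult power_mult_distrib real_sqrt_mult flip: sum_distrib_left)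

text \<open>The supremum in \<open>spec_norm\<close> is informative only for a bounded set. The sum
  of the moduli of all entries is a crude bound, but finiteness suffices.\<close>

lemma spec_norm_bdd_above:
  "bdd_above {vnorm (X *\<^sub>v v) | v. v \<in> carrier_vec (dim_col X) \<and> vnorm v \<le> 1}"
proof (rule bdd_aboveI)
  fix y assume "y \<in> {vnorm (X *\<^sub>v v) | v. v \<in> carrier_vec (dim_col X) \<and> vnorm v \<le> 1}"
  then obtain v where v: "v \<in> carrier_vec (dim_col X)" "vnorm v \<le> 1" "y = vnorm (X *\<^sub>v v)" by blast
  have "y \<le> (\<Sum>i<dim_row X. cmod ((X *\<^sub>v v) $ i))"
    unfolding v(3) vnorm_L2 dim_mult_mat_vec by (rule L2_set_le_sum) simp
  also have "\<dots> \<le> (\<Sum>i<dim_row X. \<Sum>j<dim_col X. cmod (X $$ (i, j)))"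
  proof (rule sum_mono)
    fix i assume i: "i \<in> {..<dim_row X}"
    have "(X *\<^sub>v v) $ i = (\<Sum>j<dim_col X. X $$ (i, j) * v $ j)"
      using i v(1) by (simp add: scalar_prod_def atLeast0LessThan)
    also have "cmod \<dots> \<le> (\<Sum>j<dim_col X. cmod (X $$ (i, j)))"
    proof (rule sum_norm_le)
      fix j assume "j \<in> {..<dim_col X}"
      then have "cmod (v $ j) \<le> 1" using cmod_le_vnorm[of j v] v by auto
      then show "cmod (X $$ (i, j) * v $ j) \<le> cmod (X $$ (i, j))"
        by (simp add: norm_mult mult_left_le)
    qed
    finally show "cmod ((X *\<^sub>v v) $ i) \<le> (\<Sum>j<dim_col X. cmod (X $$ (i, j)))" .
  qed
  finally show "y \<le> (\<Sum>i<dim_row X. \<Sum>j<dim_col X. cmod (X $$ (i, j)))" .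
qed

lemma vnorm_le_spec_norm:
  assumes "v \<in> carrier_vec (dim_col X)" "vnorm v \<le> 1"
  shows "vnorm (X *\<^sub>v v) \<le> spec_norm X"
  unfolding spec_norm_def using assms by (intro cSup_upper spec_norm_bdd_above) blast

lemma spec_norm_nonneg: "0 \<le> spec_norm X"
proof -
  have "vnorm (0\<^sub>v (dim_col X)) = 0" by (simp add: vnorm_def)
  then show ?thesis
    using vnorm_le_spec_norm[of "0\<^sub>v (dim_col X)" X] vnorm_nonneg order_trans by fastforce
qed

lemma vnorm_mult_mat_vec_le:
  assumes v: "v \<in> carrier_vec (dim_col X)"
  shows "vnorm (X *\<^sub>v v) \<le> spec_norm X * vnorm v"
proof (cases "vnorm v = 0")
  case True
  then have "v = 0\<^sub>v (dim_col X)" using v cmod_le_vnorm[of _ v]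
    by (intro eq_vecI) (auto simp: order_antisym)
  then show ?thesis by (simp add: vnorm_def)
next
  case False
  then have pos: "0 < vnorm v" using vnorm_nonneg[of v] by simp
  let ?a = "complex_of_real (inverse (vnorm v))"
  have a: "cmod ?a = inverse (vnorm v)" using pos by (simp add: norm_inverse)
  have "vnorm (?a \<cdot>\<^sub>v v) \<le> 1" unfolding vnorm_smult a using pos by simp
  then have "vnorm (X *\<^sub>v (?a \<cdot>\<^sub>v v)) \<le> spec_norm X"
    using v by (intro vnorm_le_spec_norm) auto
  also have "X *\<^sub>v (?a \<cdot>\<^sub>v v) = ?a \<cdot>\<^sub>v (X *\<^sub>v v)"
    using v by (intro mult_mat_vec) auto
  finally show ?thesis unfolding vnorm_smult a using pos by (simp add: field_simps)
qed

text \<open>A single coordinate is at most the norm of the image vector. This rowwise form is the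
  only way in which the spectral norm enters the error estimates.\<close>

lemma spec_norm_row:
  assumes "X \<in> carrier_mat m p" "j < m"
  shows "(cmod (\<Sum>i<p. X $$ (j, i) * v i))\<^sup>2 \<le> (spec_norm X)\<^sup>2 * (\<Sum>i<p. (cmod (v i))\<^sup>2)"
proof -
  have "cmod (\<Sum>i<p. X $$ (j, i) * v i) = cmod ((X *\<^sub>v vec p v) $ j)"
    using assms by (simp add: scalar_prod_def atLeast0LessThan)
  also have "\<dots> \<le> vnorm (X *\<^sub>v vec p v)" using assms by (intro cmod_le_vnorm) simp
  also have "\<dots> \<le> spec_norm X * vnorm (vec p v)" using assms by (intro vnorm_mult_mat_vec_le) simp
  finally have "(cmod (\<Sum>i<p. X $$ (j, i) * v i))\<^sup>2 \<le> (spec_norm X * vnorm (vec p v))\<^sup>2"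
    by (rule power_mono) simp
  then show ?thesis by (simp add: power_mult_distrib vnorm_def sum_nonneg)
qed

section \<open>Estimates for the diagonal of the error projector\<close>

text \<open>Here \<open>S\<close> is the projector \<open>1 - Q Q\<^sup>*\<close> in the eigenbasis, \<open>X\<close> is
  \<open>\<Omega>\<^sub>2 \<Omega>\<^sub>1\<^sup>\<dagger>\<close> with its rows numbered from \<open>k\<close>, and \<open>psi i\<close> is the value
  at \<open>lam i\<close> of a polynomial of degree \<open>q - 1\<close>.\<close>

locale galerkin_error =
  fixes n k :: nat and S X :: "nat \<Rightarrow> nat \<Rightarrow> complex" and lam psi :: "nat \<Rightarrow> real"
    and \<mu> \<nu> c s :: real
  assumes kn: "k \<le> n"
    and herm: "\<And>i j. i < n \<Longrightarrow> j < n \<Longrightarrow> S j i = cnj (S i j)"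
    and idem: "\<And>i j. i < n \<Longrightarrow> j < n \<Longrightarrow> (\<Sum>a<n. S i a * S a j) = S i j"
    and galerkin: "\<And>a i. a < n \<Longrightarrow> i < k \<Longrightarrow>
      S a i * complex_of_real (lam i * psi i) =
      - (\<Sum>j\<in>{k..<n}. S a j * complex_of_real (lam j * psi j) * X j i)"
    and pos: "0 < \<mu>" "0 < c" "0 \<le> s"
    and head: "\<And>i. i < k \<Longrightarrow> \<mu> \<le> lam i" "\<And>i. i < k \<Longrightarrow> c \<le> psi i"
    and tail: "\<And>j. k \<le> j \<Longrightarrow> j < n \<Longrightarrow> 0 \<le> lam j" "\<And>j. k \<le> j \<Longrightarrow> j < n \<Longrightarrow> lam j \<le> \<nu>"
      "\<And>j. k \<le> j \<Longrightarrow> j < n \<Longrightarrow> \<bar>psi j\<bar> \<le> 1"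
    and opnorm: "\<And>j v. k \<le> j \<Longrightarrow> j < n \<Longrightarrow>
      (cmod (\<Sum>i<k. X j i * v i))\<^sup>2 \<le> s\<^sup>2 * (\<Sum>i<k. (cmod (v i))\<^sup>2)"
begin

text \<open>Idempotence writes the entry as a product of row and column \<open>i\<close>, and these
  are conjugate to each other.\<close>

lemma S_diag:
  assumes "i < n"
  shows "S i i = complex_of_real (\<Sum>a<n. (cmod (S i a))\<^sup>2)"
proof -
  have "S i i = (\<Sum>a<n. S i a * cnj (S i a))"
    using idem[OF assms assms] herm assms by (metis (no_types, lifting) lessThan_iff sum.cong)
  then show ?thesis by (simp only: of_real_sum complex_norm_square)
qed

lemma Re_S_diag: "i < n \<Longrightarrow> Re (S i i) = (\<Sum>a<n. (cmod (S i a))\<^sup>2)"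
  using S_diag[of i] by simp

lemma Re_S_diag_nonneg: "i < n \<Longrightarrow> 0 \<le> Re (S i i)"
  by (simp add: Re_S_diag sum_nonneg)

text \<open>The square of the diagonal entry is one of the terms in the squared norm of its row,
  which equals the entry itself; so the entry dominates its own square.\<close>

lemma Re_S_diag_le_1:
  assumes "i < n" shows "Re (S i i) \<le> 1"
proof -
  have "(Re (S i i))\<^sup>2 = (cmod (S i i))\<^sup>2"
    using S_diag[OF assms] Re_S_diag[OF assms] by (metis norm_of_real power2_abs)
  also have "\<dots> \<le> (\<Sum>a<n. (cmod (S i a))\<^sup>2)"
    using assms by (intro member_le_sum) auto
  also have "\<dots> = Re (S i i)" using Re_S_diag[OF assms] by simp
  finally have "Re (S i i) * Re (S i i) \<le> 1 * Re (S i i)" by (simp add: power2_eq_square)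
  then show ?thesis using Re_S_diag_nonneg[OF assms]
    by (cases "Re (S i i) = 0") (auto simp only: mult_le_cancel_right)
qed

text \<open>Testing \<open>opnorm\<close> on the conjugated row gives the square of the row sum on
  the left and the row sum itself on the right, and one factor cancels.\<close>

lemma X_row_bound:
  assumes "k \<le> j" "j < n"
  shows "(\<Sum>i<k. (cmod (X j i))\<^sup>2) \<le> s\<^sup>2"
proof -
  let ?r = "\<Sum>i<k. (cmod (X j i))\<^sup>2"
  have r: "0 \<le> ?r" by (intro sum_nonneg) simp
  have "(\<Sum>i<k. X j i * cnj (X j i)) = complex_of_real ?r"
    by (simp only: of_real_sum complex_norm_square)
  then have "?r\<^sup>2 \<le> s\<^sup>2 * ?r"
    using opnorm[OF assms, of "\<lambda>i. cnj (X j i)"] by (simp add: norm_of_real del: of_real_sum)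
  then show ?thesis using r by (cases "?r = 0") (auto simp: power2_eq_square)
qed

text \<open>The tail accounts for the summand 1 in both bounds, because its diagonal entries are at
  most one. Only the indices below \<open>k\<close> remain to be estimated.\<close>

lemma trace_split:
  assumes "(\<Sum>i<k. lam i * Re (S i i)) \<le> b * (\<Sum>j\<in>{k..<n}. lam j)"
  shows "(\<Sum>i<n. lam i * Re (S i i)) \<le> (1 + b) * (\<Sum>j\<in>{k..<n}. lam j)"
proof -
  have "(\<Sum>j\<in>{k..<n}. lam j * Re (S j j)) \<le> (\<Sum>j\<in>{k..<n}. lam j)"
  proof (rule sum_mono)
    fix j assume "j \<in> {k..<n}"
    then show "lam j * Re (S j j) \<le> lam j"
      using tail(1)[of j] Re_S_diag_le_1[of j] by (simp add: mult_left_le)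
  qed
  moreover have "(\<Sum>i<n. lam i * Re (S i i))
      = (\<Sum>i<k. lam i * Re (S i i)) + (\<Sum>j\<in>{k..<n}. lam j * Re (S j j))"
    using sum.atLeastLessThan_concat[of 0 k n, symmetric] kn by (simp add: atLeast0LessThan)
  ultimately show ?thesis using assms by (simp add: algebra_simps)
qed

lemma trace_nonneg: "0 \<le> (\<Sum>i<n. lam i * Re (S i i))"
proof (intro sum_nonneg mult_nonneg_nonneg)
  fix i assume "i \<in> {..<n}"
  then show "0 \<le> lam i" using head(1)[of i] tail(1)[of i] pos by (cases "i < k") auto
qed (simp add: Re_S_diag_nonneg)

lemma head_pos: "i < k \<Longrightarrow> 0 < lam i" "i < k \<Longrightarrow> 0 < psi i"
  using head[of i] pos by linarith+

lemma trace_bound_linear: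
  "(\<Sum>i<n. lam i * Re (S i i)) \<le> (1 + s / c) * (\<Sum>j\<in>{k..<n}. lam j)"
proof (rule trace_split)
  define y where "y j = (\<Sum>i<k. X j i * (S i j / complex_of_real (psi i)))" for j
  \<comment> \<open>Row \<open>j\<close> of \<open>X\<close> acts on part of column \<open>j\<close>
    of \<open>S\<close>, with weights at most \<open>1 / c\<close>. That column has squared norm
    \<open>S j j\<close>, hence at most one.\<close>
  have y: "cmod (y j) \<le> s / c" if j: "k \<le> j" "j < n" for j
  proof -
    have "(\<Sum>i<k. (cmod (S i j / complex_of_real (psi i)))\<^sup>2) \<le> (\<Sum>i<k. (cmod (S j i))\<^sup>2 / c\<^sup>2)"
    proof (rule sum_mono)
      fix i assume "i \<in> {..<k}"
      then have i: "i < k" "i < n" using kn by auto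
      have "cmod (S i j) = cmod (S j i)" using herm[OF i(2) j(2)] by simp
      then have "cmod (S i j / complex_of_real (psi i)) \<le> cmod (S j i) / c"
        using head(2)[OF i(1)] pos(2) head_pos(2)[OF i(1)]
        by (simp add: norm_divide frac_le)
      then show "(cmod (S i j / complex_of_real (psi i)))\<^sup>2 \<le> (cmod (S j i))\<^sup>2 / c\<^sup>2"
        unfolding power_divide[symmetric] by (rule power_mono) simp
    qed
    also have "\<dots> \<le> (\<Sum>a<n. (cmod (S j a))\<^sup>2 / c\<^sup>2)"
      using kn by (intro sum_mono2) auto
    also have "\<dots> = Re (S j j) / c\<^sup>2"
      using Re_S_diag[OF j(2)] by (simp add: sum_divide_distrib)
    also have "\<dots> \<le> 1 / c\<^sup>2"
      using Re_S_diag_le_1[OF j(2)] by (intro divide_right_mono) auto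
    finally have "s\<^sup>2 * (\<Sum>i<k. (cmod (S i j / complex_of_real (psi i)))\<^sup>2) \<le> s\<^sup>2 * (1 / c\<^sup>2)"
      by (rule mult_left_mono) simp
    with opnorm[OF j, of "\<lambda>i. S i j / complex_of_real (psi i)"]
    have "(cmod (y j))\<^sup>2 \<le> s\<^sup>2 * (1 / c\<^sup>2)"
      unfolding y_def by (rule order_trans)
    then have "(cmod (y j))\<^sup>2 \<le> (s / c)\<^sup>2" by (simp add: power_divide)
    then show ?thesis using pos by (auto intro: power2_le_imp_le)
  qed
  have "complex_of_real (\<Sum>i<k. lam i * Re (S i i)) = (\<Sum>i<k. complex_of_real (lam i) * S i i)"
    unfolding of_real_sum of_real_mult
  proof (rule sum.cong)
    fix i assume "i \<in> {..<k}"
    then have "i < n" using kn by simp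
    from S_diag[OF this] Re_S_diag[OF this]
    show "complex_of_real (lam i) * complex_of_real (Re (S i i)) = complex_of_real (lam i) * S i i"
      by metis
  qed simp
  \<comment> \<open>Relation \<open>galerkin\<close> at \<open>a = i\<close> is divided by
    \<open>psi i\<close> alone, so that the weight \<open>lam i\<close> of the trace stays on the
    left.\<close>
  also have "\<dots> = (\<Sum>i<k. - (\<Sum>j\<in>{k..<n}. S i j * complex_of_real (lam j * psi j) * X j i)
      / complex_of_real (psi i))"
  proof (rule sum.cong)
    fix i assume "i \<in> {..<k}"
    then have i: "i < k" "i < n" using kn by auto
    show "complex_of_real (lam i) * S i i = - (\<Sum>j\<in>{k..<n}. S i j * complex_of_real (lam j * psi j) * X j i)
      / complex_of_real (psi i)"
      unfolding galerkin[OF i(2,1), symmetric] using head_pos[OF i(1)] by simp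
  qed simp
  also have "\<dots> = (\<Sum>i<k. - (\<Sum>j\<in>{k..<n}.
      complex_of_real (lam j * psi j) * (X j i * (S i j / complex_of_real (psi i)))))"
    by (simp add: sum_divide_distrib mult_ac)
  also have "\<dots> = - (\<Sum>j\<in>{k..<n}. complex_of_real (lam j * psi j) * y j)"
    unfolding y_def sum_negf sum_distrib_left by (subst sum.swap) simp
  finally have "\<bar>\<Sum>i<k. lam i * Re (S i i)\<bar> = cmod (\<Sum>j\<in>{k..<n}. complex_of_real (lam j * psi j) * y j)"
    by (simp only: norm_of_real[symmetric, where 'a = complex] norm_minus_cancel)
  also have "\<dots> \<le> (\<Sum>j\<in>{k..<n}. lam j * (s / c))"
  proof (rule sum_norm_le)
    fix j assume "j \<in> {k..<n}"
    then have j: "k \<le> j" "j < n" by auto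
    have "lam j * \<bar>psi j\<bar> * cmod (y j) \<le> lam j * 1 * (s / c)"
      using tail(1)[OF j] by (intro mult_mono mult_left_mono tail(3)[OF j] y[OF j]) simp_all
    then show "cmod (complex_of_real (lam j * psi j) * y j) \<le> lam j * (s / c)"
      using tail(1)[OF j] by (simp add: norm_mult abs_mult)
  qed
  finally show "(\<Sum>i<k. lam i * Re (S i i)) \<le> s / c * (\<Sum>j\<in>{k..<n}. lam j)"
    by (simp add: sum_distrib_left sum_distrib_right mult_ac)
qed

text \<open>With \<open>D\<close> the diagonal entry and \<open>F\<close> the right-hand side,
  \<open>galerkin\<close> at \<open>a = i\<close> and Cauchy-Schwarz give
  \<open>D * D \<le> D * F\<close>. Cancelling \<open>D\<close> is possible unless it is zero, and
  then \<open>0 \<le> F\<close> is enough.\<close>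

lemma Re_S_diag_head:
  assumes "i < k"
  shows "Re (S i i) \<le> (\<Sum>j\<in>{k..<n}. (lam j * psi j * cmod (X j i) / (lam i * psi i))\<^sup>2)"
    (is "_ \<le> ?F")
proof -
  have i: "i < n" using assms kn by simp
  let ?D = "Re (S i i)"
  let ?f = "\<lambda>j. \<bar>lam j * psi j\<bar> * cmod (X j i) / (lam i * psi i)"
  have p: "0 < lam i * psi i" using head_pos[OF assms] by simp
  then have "cmod (S i i) = cmod (S i i * complex_of_real (lam i * psi i)) / (lam i * psi i)"
    by (simp only: norm_mult norm_of_real abs_of_pos) (metis less_irrefl nonzero_mult_div_cancel_right)
  also have "\<dots> = cmod (\<Sum>j\<in>{k..<n}. S i j * complex_of_real (lam j * psi j) * X j i) / (lam i * psi i)"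
    unfolding galerkin[OF i assms] by simp
  also have "\<dots> \<le> (\<Sum>j\<in>{k..<n}. cmod (S i j) * \<bar>lam j * psi j\<bar> * cmod (X j i)) / (lam i * psi i)"
    using p by (intro divide_right_mono sum_norm_le) (simp_all only: norm_mult norm_of_real order_refl less_imp_le)
  also have "\<dots> = (\<Sum>j\<in>{k..<n}. cmod (S i j) * ?f j)"
    by (simp add: sum_divide_distrib mult.assoc)
  finally have "?D\<^sup>2 \<le> (\<Sum>j\<in>{k..<n}. cmod (S i j) * ?f j)\<^sup>2"
    using Re_S_diag_nonneg[OF i] complex_Re_le_cmod[of "S i i"] by (intro power_mono) auto
  then have "?D\<^sup>2 \<le> (\<Sum>j\<in>{k..<n}. (cmod (S i j))\<^sup>2) * (\<Sum>j\<in>{k..<n}. (?f j)\<^sup>2)"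
    using Cauchy_Schwarz_ineq_sum by (rule order_trans)
  also have "(\<Sum>j\<in>{k..<n}. (?f j)\<^sup>2) = ?F"
    by (simp only: power_divide power_mult_distrib power2_abs)
  also have "(\<Sum>j\<in>{k..<n}. (cmod (S i j))\<^sup>2) * ?F \<le> ?D * ?F"
  proof (rule mult_right_mono)
    show "(\<Sum>j\<in>{k..<n}. (cmod (S i j))\<^sup>2) \<le> ?D"
      unfolding Re_S_diag[OF i] by (rule sum_mono2) auto
  qed (rule sum_nonneg, rule zero_le_power2)
  finally have "?D * ?D \<le> ?D * ?F" by (simp only: power2_eq_square)
  moreover have "0 \<le> ?F" by (rule sum_nonneg) simp
  ultimately show ?thesis
    using Re_S_diag_nonneg[OF i] mult_le_cancel_left_pos[of ?D ?D ?F] by linarith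
qed

lemma trace_bound_quadratic:
  "(\<Sum>i<n. lam i * Re (S i i)) \<le> (1 + \<nu> / \<mu> * s\<^sup>2 / c\<^sup>2) * (\<Sum>j\<in>{k..<n}. lam j)"
proof (rule trace_split)
  have "(\<Sum>i<k. lam i * Re (S i i)) \<le>
      (\<Sum>i<k. \<Sum>j\<in>{k..<n}. lam j * (\<nu> / (\<mu> * c\<^sup>2)) * (cmod (X j i))\<^sup>2)"
  proof (rule sum_mono)
    fix i assume "i \<in> {..<k}"
    then have i: "i < k" by simp
    note p = head_pos[OF i]
    have "lam i * Re (S i i) \<le> lam i * (\<Sum>j\<in>{k..<n}. (lam j * psi j * cmod (X j i) / (lam i * psi i))\<^sup>2)"
      using Re_S_diag_head[OF i] p(1) by simp
    \<comment> \<open>The weight \<open>lam i\<close> cancels one of its two powers in the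
      denominator. Of the two factors \<open>lam j\<close>, one is kept to form the tail trace and
      the other is bounded by \<open>\<nu>\<close>.\<close>
    also have "\<dots> = (\<Sum>j\<in>{k..<n}. (lam j * (lam j * (psi j)\<^sup>2)) / (lam i * (psi i)\<^sup>2) * (cmod (X j i))\<^sup>2)"
      unfolding sum_distrib_left using p
      by (intro sum.cong) (auto simp: power2_eq_square field_simps)
    also have "\<dots> \<le> (\<Sum>j\<in>{k..<n}. (lam j * (\<nu> * 1)) / (\<mu> * c\<^sup>2) * (cmod (X j i))\<^sup>2)"
    proof (intro sum_mono mult_right_mono frac_le mult_mono power_mono mult_left_mono)
      fix j assume "j \<in> {k..<n}"
      then have j: "k \<le> j" "j < n" by auto
      show "0 \<le> lam j" "lam j \<le> \<nu>" using tail[OF j] by auto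
      show "0 \<le> lam j * (\<nu> * 1)" "0 \<le> \<nu>" using tail(1,2)[OF j] by auto
      show "0 \<le> lam j * (psi j)\<^sup>2" using tail(1)[OF j] by simp
      show "(psi j)\<^sup>2 \<le> 1" using tail(3)[OF j] by (simp add: abs_square_le_1)
    qed (use head[OF i] p pos in auto)
    finally show "lam i * Re (S i i) \<le> (\<Sum>j\<in>{k..<n}. lam j * (\<nu> / (\<mu> * c\<^sup>2)) * (cmod (X j i))\<^sup>2)"
      by simp
  qed
  also have "\<dots> = (\<Sum>j\<in>{k..<n}. lam j * (\<nu> / (\<mu> * c\<^sup>2)) * (\<Sum>i<k. (cmod (X j i))\<^sup>2))"
    by (subst sum.swap) (simp add: sum_distrib_left)
  also have "\<dots> \<le> (\<Sum>j\<in>{k..<n}. lam j * (\<nu> / (\<mu> * c\<^sup>2)) * s\<^sup>2)"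
  proof (intro sum_mono mult_left_mono)
    fix j assume "j \<in> {k..<n}"
    then have j: "k \<le> j" "j < n" by auto
    show "(\<Sum>i<k. (cmod (X j i))\<^sup>2) \<le> s\<^sup>2" using X_row_bound[OF j] .
    show "0 \<le> lam j * (\<nu> / (\<mu> * c\<^sup>2))" using tail(1,2)[OF j] pos by auto
  qed
  also have "\<dots> = \<nu> / \<mu> * s\<^sup>2 / c\<^sup>2 * (\<Sum>j\<in>{k..<n}. lam j)"
    by (simp add: sum_distrib_left sum_distrib_right sum_divide_distrib mult_ac)
  finally show "(\<Sum>i<k. lam i * Re (S i i)) \<le> \<nu> / \<mu> * s\<^sup>2 / c\<^sup>2 * (\<Sum>j\<in>{k..<n}. lam j)" .
qed

end

section \<open>Spectral data and the Krylov space\<close>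

text \<open>The quadratic form of \<open>A\<close> at the unit eigenvector \<open>col U j\<close>
  takes the value \<open>lam j\<close>.\<close>

lemma psd_eigenvalue_nonneg:
  assumes A: "A \<in> carrier_mat n n" and psd: "psd_mat A"
    and U: "U \<in> carrier_mat n n" and UU: "mat_adjoint U * U = 1\<^sub>m n"
    and AU: "A * U = U * mat_diag n (\<lambda>i. complex_of_real (lam i))" and j: "j < n"
  shows "0 \<le> lam j"
proof -
  note Ua = adjoint_carrier[OF U]
  have "A *\<^sub>v col U j = col (U * mat_diag n (\<lambda>i. complex_of_real (lam i))) j"
    using col_mult2[OF A U j] AU by simp
  then have "(A *\<^sub>v col U j) $ i = complex_of_real (lam j) * U $$ (i, j)" if "i < n" for i
    using that U j by (simp add: mat_diag_mult_right[OF U] mult.commute)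
  then have "(\<Sum>i<dim_row A. cnj (col U j $ i) * (A *\<^sub>v col U j) $ i)
      = (\<Sum>i<n. complex_of_real (lam j) * (mat_adjoint U $$ (j, i) * U $$ (i, j)))"
    using A U j by (intro sum.cong) auto
  also have "\<dots> = complex_of_real (lam j) * (mat_adjoint U * U) $$ (j, j)"
    unfolding index_mult_sum[OF Ua U j j] by (simp add: sum_distrib_left)
  also have "\<dots> = complex_of_real (lam j)" using j unfolding UU by simp
  finally have quad: "(\<Sum>i<dim_row A. cnj (col U j $ i) * (A *\<^sub>v col U j) $ i) = complex_of_real (lam j)" .
  have "col U j \<in> carrier_vec (dim_row A)" using A U col_dim[of U j] by simp
  then have "0 \<le> complex_of_real (lam j)"
    using psd unfolding psd_mat_def quad[symmetric] by blast
  then show ?thesis by (simp add: less_eq_complex_def)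
qed

lemma unitary_diag_pow:
  fixes U :: "complex mat"
  assumes U: "U \<in> carrier_mat n n" and UU: "mat_adjoint U * U = 1\<^sub>m n" "U * mat_adjoint U = 1\<^sub>m n"
  shows "(U * mat_diag n f * mat_adjoint U) ^\<^sub>m m = U * mat_diag n (\<lambda>i. f i ^ m) * mat_adjoint U"
proof -
  have "similar_mat_wit (U * mat_diag n f * mat_adjoint U) (mat_diag n f) U (mat_adjoint U)"
    using U UU by (intro similar_mat_witI[of _ _ n]) auto
  from similar_mat_wit_pow_id[OF this] show ?thesis by (simp add: mat_diag_pow)
qed

text \<open>Blocks are counted from zero while the powers of \<open>A\<close> start at one, hence
  the exponent \<open>m + 1\<close>.\<close>

lemma krylov_col:
  assumes A: "A \<in> carrier_mat n n" and Om: "\<Omega> \<in> carrier_mat n l" and m: "m < q" and b: "b < l"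
  shows "col (krylov A \<Omega> q) (m * l + b) = col (A ^\<^sub>m (m + 1) * \<Omega>) b"
proof -
  have "m * l + b < Suc m * l" using b by simp
  also have "\<dots> \<le> q * l" using m by (intro mult_le_mono1) simp
  finally have "m * l + b < q * l" .
  moreover have "(m * l + b) div l = m" "(m * l + b) mod l = b" using b by auto
  ultimately show ?thesis using A Om b
    by (intro eq_vecI) (auto simp: krylov_def pow_mat_dim_square[OF A] simp del: index_mult_mat(1) pow_mat.simps)
qed

text \<open>\<open>Q * mat_adjoint Q\<close> acts as the identity on matrices of the form
  \<open>Q * R\<close>, so it fixes every column of the Krylov matrix, and thereby each of its
  blocks.\<close>

lemma thin_QR_fixes_krylov:
  assumes A: "A \<in> carrier_mat n n" and Om: "\<Omega> \<in> carrier_mat n l" and m: "m < q"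
    and QR: "thin_QR (krylov A \<Omega> q) Q R"
  shows "Q * mat_adjoint Q * (A ^\<^sub>m (m + 1) * \<Omega>) = A ^\<^sub>m (m + 1) * \<Omega>"
proof -
  let ?K = "krylov A \<Omega> q"
  let ?M = "A ^\<^sub>m (m + 1) * \<Omega>"
  have K: "?K \<in> carrier_mat n (q * l)" using Om by (auto simp: krylov_def)
  have Q: "Q \<in> carrier_mat n (q * l)" and R: "R \<in> carrier_mat (q * l) (q * l)"
    and QQ: "mat_adjoint Q * Q = 1\<^sub>m (q * l)" and KQR: "?K = Q * R"
    using QR K unfolding thin_QR_def by auto
  note Qa = adjoint_carrier[OF Q]
  have P: "Q * mat_adjoint Q \<in> carrier_mat n n" using Q Qa by auto
  have M: "?M \<in> carrier_mat n l" using pow_carrier_mat[OF A] Om by (rule mult_carrier_mat)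
  have "Q * mat_adjoint Q * ?K = Q * (mat_adjoint Q * (Q * R))"
    using assoc_mult_mat[OF Q Qa K] KQR by simp
  also have "\<dots> = ?K"
    using assoc_mult_mat[OF Qa Q R] QQ left_mult_one_mat[OF R] KQR by simp
  finally have PK: "Q * mat_adjoint Q * ?K = ?K" .
  show ?thesis
  proof (rule mat_col_eqI)
    fix b assume "b < dim_col ?M"
    then have b: "b < l" using Om by simp
    have "m * l + b < Suc m * l" using b by simp
    also have "\<dots> \<le> q * l" using m by (intro mult_le_mono1) simp
    finally have mb: "m * l + b < q * l" .
    have "col (Q * mat_adjoint Q * ?M) b = Q * mat_adjoint Q *\<^sub>v col ?K (m * l + b)"
      using col_mult2[OF P M b] krylov_col[OF A Om m b] by simp
    also have "\<dots> = col ?K (m * l + b)"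
      using col_mult2[OF P K mb] PK by simp
    finally show "col (Q * mat_adjoint Q * ?M) b = col ?M b"
      using krylov_col[OF A Om m b] by simp
  qed (simp_all only: carrier_matD[OF M] carrier_matD[OF mult_carrier_mat[OF P M]])
qed

section \<open>The trace error in the eigenbasis of \<open>A\<close>\<close>

theorem theorem5:
  fixes A U \<Omega> Q R :: "complex mat" and lam :: "nat \<Rightarrow> real" and n k l q :: nat
  assumes A: "A \<in> carrier_mat n n" and herm: "hermitian_mat A" and psd: "psd_mat A"
    and U: "U \<in> carrier_mat n n" and unit: "unitary_mat U"
    and eig: "A = U * mat_diag n (\<lambda>i. complex_of_real (lam i)) * mat_adjoint U"
    and sorted: "\<And>i j. i \<le> j \<Longrightarrow> j < n \<Longrightarrow> lam j \<le> lam i"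
    and k: "1 \<le> k" "k < n"
    and gap: "lam (k - 1) > lam k" "lam k > 0"
    and q: "q \<ge> 1" and l: "k \<le> l" "l \<le> n"
    and Om: "\<Omega> \<in> carrier_mat n l"
    and rank1: "mat_rank (mat_adjoint (col_block U 0 k) * \<Omega>) = k"
    and rankK: "mat_rank (krylov A \<Omega> q) = q * l"
    and QR: "thin_QR (krylov A \<Omega> q) Q R"
  shows
    "let \<Omega>1 = mat_adjoint (col_block U 0 k) * \<Omega>;
         \<Omega>2 = mat_adjoint (col_block U k (n - k)) * \<Omega>;
         T = mat_adjoint Q * A * Q;
         d = mat_trace A - mat_trace T;
         trL2 = (\<Sum>i\<in>{k..<n}. lam i);
         c = cheb (q - 1) ((2 * lam (k - 1) - lam k) / lam k)
     in (0 \<le> d \<and> d \<le> complex_of_real ((1 + spec_norm (\<Omega>2 * pinv \<Omega>1) / c) * trL2)) \<and>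
        (0 < spec_norm (\<Omega>2 * pinv \<Omega>1) \<and>
           spec_norm (\<Omega>2 * pinv \<Omega>1) \<le> lam (k - 1) / lam k * c \<longrightarrow>
           0 \<le> d \<and> d \<le> complex_of_real
             ((1 + lam k / lam (k - 1) * (spec_norm (\<Omega>2 * pinv \<Omega>1))\<^sup>2 / c\<^sup>2) * trL2))"
proof -
  let ?D = "mat_diag n (\<lambda>i. complex_of_real (lam i))"
  define X where "X = mat_adjoint (col_block U k (n - k)) * \<Omega> * pinv (mat_adjoint (col_block U 0 k) * \<Omega>)"
  define c where "c = cheb (q - 1) ((2 * lam (k - 1) - lam k) / lam k)"
  \<comment> \<open>\<open>V\<close> is \<open>Q\<close> in eigenbasis coordinates, \<open>P\<close>
    the orthogonal projector onto its range, and \<open>S\<close> the complementary projector, given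
    entrywise.\<close>
  define V where "V = mat_adjoint U * Q"
  define P where "P = V * mat_adjoint V"
  define S where "S i j = (if i = j then 1 else 0) - P $$ (i, j)" for i j
  define H where "H = mat_adjoint U * \<Omega>"
  let ?O1 = "mat_adjoint (col_block U 0 k) * \<Omega>"
  let ?O2 = "mat_adjoint (col_block U k (n - k)) * \<Omega>"
  define Y where "Y = pinv ?O1"

  have UU: "mat_adjoint U * U = 1\<^sub>m n" "U * mat_adjoint U = 1\<^sub>m n"
    using unit U unfolding unitary_mat_def by auto
  note Ua = adjoint_carrier[OF U]
  have D: "?D \<in> carrier_mat n n" by simp
  have K: "krylov A \<Omega> q \<in> carrier_mat n (q * l)" using Om by (auto simp: krylov_def)
  have Q: "Q \<in> carrier_mat n (q * l)" and QQ: "mat_adjoint Q * Q = 1\<^sub>m (q * l)"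
    using QR K unfolding thin_QR_def by auto
  note Qa = adjoint_carrier[OF Q]
  have V: "V \<in> carrier_mat n (q * l)" unfolding V_def using Ua Q by auto
  note Va = adjoint_carrier[OF V]
  have Va_eq: "mat_adjoint V = mat_adjoint Q * U" unfolding V_def adjoint_mult[OF Ua Q] by simp
  have UV: "U * V = Q"
    unfolding V_def using assoc_mult_mat[OF U Ua Q] UU left_mult_one_mat[OF Q] by simp
  have VV: "mat_adjoint V * V = 1\<^sub>m (q * l)"
    unfolding Va_eq using assoc_mult_mat[OF Qa U V] UV QQ by simp
  have P: "P \<in> carrier_mat n n" unfolding P_def using V Va by auto
  have "P * P = V * (mat_adjoint V * (V * mat_adjoint V))"
    unfolding P_def using assoc_mult_mat[OF V Va mult_carrier_mat[OF V Va]] by simp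
  also have "\<dots> = P"
    using assoc_mult_mat[OF Va V Va] VV left_mult_one_mat[OF Va] unfolding P_def by simp
  finally have PP: "P * P = P" .
  have Padj: "mat_adjoint P = P" unfolding P_def adjoint_mult[OF V Va] by simp
  have H: "H \<in> carrier_mat n l" unfolding H_def using Ua Om by auto
  have O1: "?O1 \<in> carrier_mat k l" and O2: "?O2 \<in> carrier_mat (n - k) l"
    using U Om by (auto simp: col_block_def)
  have H_O1: "H $$ (j, b) = ?O1 $$ (j, b)" if "j < k" "b < l" for j b
    using that U Om k by (simp add: H_def scalar_prod_def col_block_def)
  have H_O2: "H $$ (j, b) = ?O2 $$ (j - k, b)" if "k \<le> j" "j < n" "b < l" for j b
    using that U Om by (simp add: H_def scalar_prod_def col_block_def)
  have Y: "Y \<in> carrier_mat l k" and O1Y: "?O1 * Y = 1\<^sub>m k"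
    unfolding Y_def using pinv_full_row_rank[OF O1 rank1] by auto
  have X: "X \<in> carrier_mat (n - k) k" unfolding X_def Y_def[symmetric] using O2 Y by auto
  \<comment> \<open>\<open>H * Y\<close> is the identity stacked on \<open>X\<close>, since
    \<open>Y\<close> is a right inverse of the upper block of \<open>H\<close>. This later isolates
    one head index at a time.\<close>
  have HY: "(\<Sum>b<l. H $$ (j, b) * Y $$ (b, i)) = (if j < k then if j = i then 1 else 0 else X $$ (j - k, i))"
    if "j < n" "i < k" for j i
  proof (cases "j < k")
    case True
    then have "(\<Sum>b<l. H $$ (j, b) * Y $$ (b, i)) = (?O1 * Y) $$ (j, i)"
      unfolding index_mult_sum[OF O1 Y True that(2)] by (intro sum.cong) (auto simp: H_O1)
    then show ?thesis using True that unfolding O1Y by simp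
  next
    case False
    then have j: "j - k < n - k" using that by simp
    have "(\<Sum>b<l. H $$ (j, b) * Y $$ (b, i)) = (?O2 * Y) $$ (j - k, i)"
      unfolding index_mult_sum[OF O2 Y j that(2)] using False that by (intro sum.cong) (auto simp: H_O2)
    then show ?thesis using False unfolding X_def Y_def by simp
  qed

  have AU: "A * U = U * ?D"
    unfolding eig using assoc_mult_mat[OF mult_carrier_mat[OF U D] Ua U] UU
      right_mult_one_mat[OF mult_carrier_mat[OF U D]] by simp
  have lam_nonneg: "0 \<le> lam j" if "j < n" for j
    using psd_eigenvalue_nonneg[OF A psd U UU(1) AU that] .

  \<comment> \<open>In the eigenbasis a Krylov block becomes a power of the diagonal matrix times
    \<open>H\<close>; \<open>P\<close> fixes it, so \<open>S\<close> annihilates it.\<close>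
  have krylov0: "(\<Sum>j<n. S a j * (complex_of_real (lam j) ^ (m + 1) * H $$ (j, b))) = 0"
    if a: "a < n" and m: "m < q" and b: "b < l" for a m b
  proof -
    let ?M = "A ^\<^sub>m (m + 1) * \<Omega>"
    let ?Dm = "mat_diag n (\<lambda>i. complex_of_real (lam i) ^ (m + 1))"
    have M: "?M \<in> carrier_mat n l" using pow_carrier_mat[OF A] Om by (rule mult_carrier_mat)
    have Dm: "?Dm \<in> carrier_mat n n" by simp
    have DH: "?Dm * H \<in> carrier_mat n l" using Dm H by (rule mult_carrier_mat)
    have "A ^\<^sub>m (m + 1) = U * ?Dm * mat_adjoint U"
      unfolding eig by (rule unitary_diag_pow[OF U UU])
    then have "?M = U * (?Dm * H)"
      unfolding H_def using assoc_mult_mat[OF mult_carrier_mat[OF U Dm] Ua Om]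
        assoc_mult_mat[OF U Dm mult_carrier_mat[OF Ua Om]] by simp
    then have DH_eq: "mat_adjoint U * ?M = ?Dm * H"
      using assoc_mult_mat[OF Ua U DH] UU left_mult_one_mat[OF DH] by simp
    have "P * (?Dm * H) = V * (mat_adjoint V * (mat_adjoint U * ?M))"
      unfolding P_def DH_eq using assoc_mult_mat[OF V Va DH] .
    also have "mat_adjoint V * (mat_adjoint U * ?M) = mat_adjoint Q * ?M"
      unfolding Va_eq assoc_mult_mat[OF Qa U mult_carrier_mat[OF Ua M]]
      using assoc_mult_mat[OF U Ua M] UU left_mult_one_mat[OF M] by simp
    also have "V * (mat_adjoint Q * ?M) = mat_adjoint U * (Q * mat_adjoint Q * ?M)"
      unfolding V_def assoc_mult_mat[OF Ua Q mult_carrier_mat[OF Qa M]] assoc_mult_mat[OF Q Qa M] ..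
    also have "\<dots> = ?Dm * H" unfolding thin_QR_fixes_krylov[OF A Om m QR] by (rule DH_eq)
    finally have PDH: "P * (?Dm * H) = ?Dm * H" .
    have ent: "(?Dm * H) $$ (j, b) = complex_of_real (lam j) ^ (m + 1) * H $$ (j, b)" if "j < n" for j
      unfolding mat_diag_mult_left[OF H] using that b by simp
    have "(\<Sum>j<n. P $$ (a, j) * (?Dm * H) $$ (j, b)) = (?Dm * H) $$ (a, b)"
      using PDH index_mult_sum[OF P DH a b] by simp
    moreover have "(\<Sum>j<n. (if a = j then 1 else 0) * (?Dm * H) $$ (j, b)) = (?Dm * H) $$ (a, b)"
      using a by (simp add: if_distrib[of "\<lambda>x. x * _"] sum.delta cong: if_cong)
    ultimately have "(\<Sum>j<n. S a j * (?Dm * H) $$ (j, b)) = 0"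
      unfolding S_def left_diff_distrib sum_subtractf by simp
    moreover have "(\<Sum>j<n. S a j * (?Dm * H) $$ (j, b))
        = (\<Sum>j<n. S a j * (complex_of_real (lam j) ^ (m + 1) * H $$ (j, b)))"
      by (rule sum.cong) (simp_all only: ent lessThan_iff)
    ultimately show ?thesis by simp
  qed

  \<comment> \<open>The affine map sends \<open>[0, lam k]\<close> to [-1, 1]. Eigenvalues are
    indexed from zero, so \<open>lam (k - 1)\<close> is the smallest of the head and
    \<open>lam k\<close> the largest of the tail.\<close>
  obtain p :: "real poly" where p: "degree p \<le> q - 1"
    "\<And>x. poly p x = cheb (q - 1) (2 / lam k * x + - 1)"
    using cheb_poly[of "q - 1" "2 / lam k" "- 1"] by blast
  have c: "poly p (lam (k - 1)) = c" unfolding p(2) c_def using gap by (simp add: field_simps)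
  \<comment> \<open>The factor \<open>lam j\<close> raises every exponent of \<open>p\<close> by
    one, so exactly powers between 1 and \<open>q\<close> occur, all covered by
    \<open>krylov0\<close>.\<close>
  have poly0: "(\<Sum>j<n. S a j * complex_of_real (lam j * poly p (lam j)) * H $$ (j, b)) = 0"
    if a: "a < n" and b: "b < l" for a b
  proof -
    have "(\<Sum>j<n. S a j * complex_of_real (lam j * poly p (lam j)) * H $$ (j, b))
        = (\<Sum>j<n. \<Sum>m\<le>degree p. complex_of_real (coeff p m) *
            (S a j * (complex_of_real (lam j) ^ (m + 1) * H $$ (j, b))))"
      by (simp add: poly_altdef sum_distrib_left sum_distrib_right mult_ac)
    also have "\<dots> = (\<Sum>m\<le>degree p. complex_of_real (coeff p m) *
        (\<Sum>j<n. S a j * (complex_of_real (lam j) ^ (m + 1) * H $$ (j, b))))"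
      by (subst sum.swap) (simp only: sum_distrib_left)
    also have "\<dots> = 0"
    proof (rule sum.neutral, rule ballI)
      fix m assume "m \<in> {..degree p}"
      then have "m < q" using p(1) q by auto
      then show "complex_of_real (coeff p m) *
        (\<Sum>j<n. S a j * (complex_of_real (lam j) ^ (m + 1) * H $$ (j, b))) = 0"
        using krylov0[OF a _ b] by simp
    qed
    finally show ?thesis .
  qed

  interpret galerkin_error n k S "\<lambda>j i. X $$ (j - k, i)" lam "\<lambda>i. poly p (lam i)"
    "lam (k - 1)" "lam k" c "spec_norm X"
  proof
    show "k \<le> n" using k by simp
    show "0 < lam (k - 1)" using gap by simp
    show "0 \<le> spec_norm X" by (rule spec_norm_nonneg)
    \<comment> \<open>The head is mapped beyond 1, where \<open>cheb\<close> is increasing; its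
      least value there is therefore \<open>c\<close>, attained at
      \<open>lam (k - 1)\<close>.\<close>
    have arg: "1 \<le> 2 / lam k * lam (k - 1) + - 1" using gap by (simp add: field_simps)
    show "0 < c" using cheb_ge_one[OF arg, of "q - 1"] c p(2) by simp
    show "S j i = cnj (S i j)" if "i < n" "j < n" for i j
    proof -
      have "P $$ (j, i) = cnj (P $$ (i, j))"
        using adjoint_index[of j P i] Padj P that by simp
      then show ?thesis by (simp add: S_def)
    qed
    show "(\<Sum>a<n. S i a * S a j) = S i j" if "i < n" "j < n" for i j
    proof -
      \<comment> \<open>Entrywise expansion of the square of identity minus \<open>P\<close>, to be
        closed by \<open>P * P = P\<close>.\<close>
      have "(\<Sum>a<n. S i a * S a j) = (\<Sum>a<n. (if i = a then if a = j then 1 else 0 else 0)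
          - (if i = a then P $$ (a, j) else 0) - (if a = j then P $$ (i, a) else 0) + P $$ (i, a) * P $$ (a, j))"
        by (rule sum.cong) (auto simp: S_def algebra_simps)
      also have "\<dots> = (if i = j then 1 else 0) - P $$ (i, j) - P $$ (i, j) + (P * P) $$ (i, j)"
        unfolding index_mult_sum[OF P P that] using that
        by (simp add: sum.distrib sum_subtractf sum.delta sum.delta')
      finally show ?thesis by (simp add: PP S_def)
    qed
    show "lam (k - 1) \<le> lam i" if "i < k" for i
      using sorted[of i "k - 1"] that k by simp
    then show "c \<le> poly p (lam i)" if "i < k" for i
      unfolding c[symmetric] p(2) using that gap
      by (intro cheb_mono arg) (auto simp: divide_right_mono)
    fix j assume j: "k \<le> j" "j < n"
    show "0 \<le> lam j" using lam_nonneg j by simp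
    show le: "lam j \<le> lam k" using sorted j by simp
    show "\<bar>poly p (lam j)\<bar> \<le> 1"
      unfolding p(2) using le lam_nonneg[OF j(2)] gap
      by (intro cheb_abs_le_one) (auto simp: abs_le_iff field_simps)
    show "(cmod (\<Sum>i<k. X $$ (j - k, i) * v i))\<^sup>2 \<le> (spec_norm X)\<^sup>2 * (\<Sum>i<k. (cmod (v i))\<^sup>2)" for v
      using j by (intro spec_norm_row[OF X]) simp
  next
    fix a i assume a: "a < n" and i: "i < k"
    let ?f = "\<lambda>j. S a j * complex_of_real (lam j * poly p (lam j))"
    let ?G = "\<lambda>j. if j < k then if j = i then 1 else 0 else X $$ (j - k, i)"
    \<comment> \<open>Combining the relations \<open>poly0\<close> with the entries of column
      \<open>i\<close> of \<open>Y\<close> replaces \<open>H\<close> by \<open>H * Y\<close>, whose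
      head part picks out the single term \<open>j = i\<close>.\<close>
    have "0 = (\<Sum>b<l. (\<Sum>j<n. ?f j * H $$ (j, b)) * Y $$ (b, i))"
      using poly0[OF a] by simp
    also have "\<dots> = (\<Sum>j<n. \<Sum>b<l. ?f j * (H $$ (j, b) * Y $$ (b, i)))"
      unfolding sum_distrib_right by (subst sum.swap) (simp only: mult.assoc)
    also have "\<dots> = (\<Sum>j<n. ?f j * ?G j)"
      unfolding sum_distrib_left[symmetric] using HY[OF _ i] by (intro sum.cong) auto
    also have "\<dots> = (\<Sum>j<k. ?f j * ?G j) + (\<Sum>j\<in>{k..<n}. ?f j * ?G j)"
      using sum.atLeastLessThan_concat[OF le0 less_imp_le[OF k(2)], symmetric]
      by (simp only: atLeast0LessThan)
    also have "(\<Sum>j<k. ?f j * ?G j) = ?f i"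
      using i by (simp add: if_distrib[of "\<lambda>x. _ * x"] sum.delta cong: if_cong)
    also have "(\<Sum>j\<in>{k..<n}. ?f j * ?G j) = (\<Sum>j\<in>{k..<n}. ?f j * X $$ (j - k, i))"
      by (intro sum.cong) auto
    finally show "?f i = - (\<Sum>j\<in>{k..<n}. ?f j * X $$ (j - k, i))"
      by (simp only: eq_neg_iff_add_eq_0)
  qed

  have "mat_trace A = mat_trace ?D"
  proof -
    have "mat_trace A = mat_trace (mat_adjoint U * (U * ?D))"
      unfolding eig using mat_trace_comm[OF mult_carrier_mat[OF U D] Ua] by simp
    then show ?thesis using assoc_mult_mat[OF Ua U D] UU left_mult_one_mat[OF D] by simp
  qed
  also have "\<dots> = (\<Sum>i<n. complex_of_real (lam i))"
    by (simp add: mat_trace_def mat_diag_def)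
  finally have trA: "mat_trace A = (\<Sum>i<n. complex_of_real (lam i))" .
  have DV: "?D * V \<in> carrier_mat n (q * l)" using D V by (rule mult_carrier_mat)
  \<comment> \<open>In the eigenbasis \<open>A\<close> is diagonal, and commuting the factors under
    the trace leaves only the diagonal entries of \<open>P\<close>.\<close>
  have "mat_adjoint Q * A * Q = mat_adjoint V * (?D * V)"
  proof -
    have "A * Q = A * U * V" using assoc_mult_mat[OF A U V] UV by simp
    also have "\<dots> = U * (?D * V)" unfolding AU using assoc_mult_mat[OF U D V] .
    finally have "A * Q = U * (?D * V)" .
    then show ?thesis
      unfolding Va_eq assoc_mult_mat[OF Qa A Q] using assoc_mult_mat[OF Qa U DV] by simp
  qed
  then have "mat_trace (mat_adjoint Q * A * Q) = mat_trace (?D * P)"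
    unfolding P_def using mat_trace_comm[OF Va DV] assoc_mult_mat[OF D V Va] by simp
  also have "\<dots> = (\<Sum>i<n. complex_of_real (lam i) * P $$ (i, i))"
    unfolding mat_trace_def mat_diag_mult_left[OF P] by simp
  finally have "mat_trace A - mat_trace (mat_adjoint Q * A * Q) = (\<Sum>i<n. complex_of_real (lam i) * S i i)"
    unfolding trA S_def by (simp add: sum_subtractf right_diff_distrib)
  also have "\<dots> = complex_of_real (\<Sum>i<n. lam i * Re (S i i))"
    unfolding of_real_sum of_real_mult
  proof (rule sum.cong)
    fix i assume "i \<in> {..<n}"
    then have "i < n" by simp
    from S_diag[OF this] Re_S_diag[OF this]
    show "complex_of_real (lam i) * S i i = complex_of_real (lam i) * complex_of_real (Re (S i i))"
      by metis
  qed simp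
  finally have d: "mat_trace A - mat_trace (mat_adjoint Q * A * Q)
      = complex_of_real (\<Sum>i<n. lam i * Re (S i i))" .
  \<comment> \<open>The trace difference is now the image of a real number, so each complex
    inequality reduces to a comparison of real parts.\<close>
  show ?thesis
    unfolding Let_def d X_def[symmetric] c_def[symmetric]
    using trace_nonneg trace_bound_linear trace_bound_quadratic
    by (simp only: less_eq_complex_def Re_complex_of_real Im_complex_of_real zero_complex.sel simp_thms)
qed

end
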